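(* Let $X$ be a (closed linear) subspace of $L_1[0,1]$, $f\in S_X$, and $h\in D(f)$. If $f$ is a $\mathfrak{D}$-point of $X$, then for all $\varepsilon>0$, all $\delta>0$ and all $\gamma>0$ there exist a measurable set $D\subseteq[0,1]$ with $\mu(D)<\delta$ and $g\in S(h,\gamma)$ such that $$\int_D |g|\,d\mu>1-\varepsilon.$$ In particular, if $X$ is reflexive, then $X$ does not contain any $\mathfrak{D}$-point.
   Context: All Banach spaces are real; $\mu$ denotes Lebesgue measure on $[0,1]$. $B_X$ and $S_X$ denote the closed unit ball and unit sphere of $X$. For $x^*\in X^*$ and $\alpha>0$, $S(x^*,\alpha)=\{y\in B_X:\ x^*(y)>\sup x^*(B_X)-\alpha\}$. For $x\in S_X$ let $D(x)=\{x^*\in S_{X^*}:\ x^*(x)=1\}$; a supporting slice at $x$ is a set $S(x^*,\alpha)$ with $x^*\in D(x)$ and $\alpha>0$. A point $x\in S_X$ is a $\mathfrak{D}$-point if $\sup_{y\in S}\|x-y\|=2$ for every supporting slice $S$ at $x$. *)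

theory Defs
  imports "HOL-Analysis.Analysis"
begin

section \<open>The Banach space $L_1[0,1]$\<close>

definition L1_rel :: "(real \<Rightarrow> real) \<Rightarrow> (real \<Rightarrow> real) \<Rightarrow> bool" where
  "L1_rel f g \<longleftrightarrow>
     integrable (lebesgue_on {0..1}) f \<and> integrable (lebesgue_on {0..1}) g \<and>
     (AE t in lebesgue_on {0..1}. f t = g t)"

lemma part_equivp_L1_rel: "part_equivp L1_rel"
proof (rule part_equivpI)
  show "\<exists>f. L1_rel f f"
    by (rule exI[of _ "\<lambda>_. 0"]) (simp add: L1_rel_def)
  show "symp L1_rel"
    by (auto simp: symp_def L1_rel_def)
  show "transp L1_rel"
    by (auto simp: transp_def L1_rel_def)
qed

quotient_type L1 = "real \<Rightarrow> real" / partial: L1_rel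
  by (rule part_equivp_L1_rel)

text \<open>\<open>rep_L1 g\<close> is a chosen integrable representative of the class \<open>g\<close>.\<close>

lemma L1_rel_rep: "L1_rel (rep_L1 g) (rep_L1 g)"
  using Quotient3_L1 by (rule Quotient3_rep_reflp)

lemma abs_rep_L1: "abs_L1 (rep_L1 g) = g"
  using Quotient3_L1 by (rule Quotient3_abs_rep)

lemma integrable_rep_L1: "integrable (lebesgue_on {0..1}) (rep_L1 g)"
  using L1_rel_rep[of g] by (simp add: L1_rel_def)

lemma L1_rel_rep_abs: "L1_rel (rep_L1 (abs_L1 f)) f"
  if "integrable (lebesgue_on {0..1}) f"
  using that by (intro Quotient3_rep_abs[OF Quotient3_L1]) (simp add: L1_rel_def)

instantiation L1 :: real_vector
begin

lift_definition zero_L1 :: L1 is "\<lambda>_. 0"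
  by (simp add: L1_rel_def)

lift_definition plus_L1 :: "L1 \<Rightarrow> L1 \<Rightarrow> L1" is "\<lambda>f g t. f t + g t"
  by (auto simp: L1_rel_def)

lift_definition minus_L1 :: "L1 \<Rightarrow> L1 \<Rightarrow> L1" is "\<lambda>f g t. f t - g t"
  by (auto simp: L1_rel_def)

lift_definition uminus_L1 :: "L1 \<Rightarrow> L1" is "\<lambda>f t. - f t"
  by (auto simp: L1_rel_def)

lift_definition scaleR_L1 :: "real \<Rightarrow> L1 \<Rightarrow> L1" is "\<lambda>c f t. c * f t"
  by (auto simp: L1_rel_def)

instance
  by standard (transfer; auto simp: L1_rel_def algebra_simps)+

end

instantiation L1 :: real_normed_vector
begin

lift_definition norm_L1 :: "L1 \<Rightarrow> real" is "\<lambda>f. LINT t|lebesgue_on {0..1}. \<bar>f t\<bar>"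
  by (auto simp: L1_rel_def intro!: integral_cong_AE)

definition dist_L1 :: "L1 \<Rightarrow> L1 \<Rightarrow> real" where
  "dist_L1 f g = norm (f - g)"

definition sgn_L1 :: "L1 \<Rightarrow> L1" where
  "sgn_L1 f = inverse (norm f) *\<^sub>R f"

definition uniformity_L1 :: "(L1 \<times> L1) filter" where
  "uniformity_L1 = (INF e\<in>{0<..}. principal {(x, y). dist x y < e})"

definition open_L1 :: "L1 set \<Rightarrow> bool" where
  "open_L1 U \<longleftrightarrow> (\<forall>x\<in>U. \<forall>\<^sub>F (x', y) in uniformity. x' = x \<longrightarrow> y \<in> U)"

instance
proof
  fix f g :: L1 and c :: real
  show "dist f g = norm (f - g)" by (rule dist_L1_def)
  show "sgn f = f /\<^sub>R norm f" by (rule sgn_L1_def)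
  show "(uniformity :: (L1 \<times> L1) filter) = (INF e\<in>{0<..}. principal {(x, y). dist x y < e})"
    by (rule uniformity_L1_def)
  show "open U \<longleftrightarrow> (\<forall>x\<in>U. \<forall>\<^sub>F (x', y) in uniformity. x' = x \<longrightarrow> y \<in> U)" for U :: "L1 set"
    by (rule open_L1_def)
  show "norm f = 0 \<longleftrightarrow> f = 0"
    by transfer (auto simp: L1_rel_def integral_nonneg_eq_0_iff_AE)
  show "norm (f + g) \<le> norm f + norm g"
  proof transfer
    fix f g :: "real \<Rightarrow> real"
    assume "L1_rel f f" "L1_rel g g"
    then have [simp]: "integrable (lebesgue_on {0..1}) f" "integrable (lebesgue_on {0..1}) g"
      by (auto simp: L1_rel_def)
    have "(LINT t|lebesgue_on {0..1}. \<bar>f t + g t\<bar>) \<le>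
        (LINT t|lebesgue_on {0..1}. \<bar>f t\<bar> + \<bar>g t\<bar>)"
      by (intro integral_mono) (auto intro: abs_triangle_ineq)
    then show "(LINT t|lebesgue_on {0..1}. \<bar>f t + g t\<bar>) \<le>
        (LINT t|lebesgue_on {0..1}. \<bar>f t\<bar>) + (LINT t|lebesgue_on {0..1}. \<bar>g t\<bar>)"
      by simp
  qed
  show "norm (c *\<^sub>R f) = \<bar>c\<bar> * norm f"
    by transfer (simp add: abs_mult)
qed

end

section \<open>Duality for a subspace\<close>

text \<open>
  Here \<open>X\<close> is a linear subspace of a normed space, regarded as a normed space in its own right.
  A functional on \<open>X\<close> is encoded as a function on the ambient type that vanishes off \<open>X\<close>; this
  makes the encoding unique. It need not be linear outside \<open>X\<close>.
\<close>

definition dual :: "'a::real_normed_vector set \<Rightarrow> ('a \<Rightarrow> real) set" where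
  "dual X = {h. (\<forall>x. x \<notin> X \<longrightarrow> h x = 0) \<and>
                (\<forall>x\<in>X. \<forall>y\<in>X. h (x + y) = h x + h y) \<and>
                (\<forall>c. \<forall>x\<in>X. h (c *\<^sub>R x) = c * h x) \<and>
                (\<exists>K. \<forall>x\<in>X. \<bar>h x\<bar> \<le> K * norm x)}"

definition unit_ball :: "'a::real_normed_vector set \<Rightarrow> 'a set" where
  "unit_ball X = {x \<in> X. norm x \<le> 1}"

definition unit_sphere :: "'a::real_normed_vector set \<Rightarrow> 'a set" where
  "unit_sphere X = {x \<in> X. norm x = 1}"

definition dual_norm :: "'a::real_normed_vector set \<Rightarrow> ('a \<Rightarrow> real) \<Rightarrow> real" where
  "dual_norm X h = (SUP x\<in>unit_ball X. \<bar>h x\<bar>)"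

definition bidual :: "'a::real_normed_vector set \<Rightarrow> (('a \<Rightarrow> real) \<Rightarrow> real) set" where
  "bidual X = {F. (\<forall>h. h \<notin> dual X \<longrightarrow> F h = 0) \<and>
                  (\<forall>h\<in>dual X. \<forall>k\<in>dual X. F (\<lambda>x. h x + k x) = F h + F k) \<and>
                  (\<forall>c. \<forall>h\<in>dual X. F (\<lambda>x. c * h x) = c * F h) \<and>
                  (\<exists>K. \<forall>h\<in>dual X. \<bar>F h\<bar> \<le> K * dual_norm X h)}"

definition canonical_embedding ::
  "'a::real_normed_vector set \<Rightarrow> 'a \<Rightarrow> ('a \<Rightarrow> real) \<Rightarrow> real" where
  "canonical_embedding X x = (\<lambda>h. if h \<in> dual X then h x else 0)"

definition reflexive_space :: "'a::real_normed_vector set \<Rightarrow> bool" where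
  "reflexive_space X \<longleftrightarrow> canonical_embedding X ` X = bidual X"

section \<open>Slices and $\mathfrak{D}$-points\<close>

definition slice :: "'a::real_normed_vector set \<Rightarrow> ('a \<Rightarrow> real) \<Rightarrow> real \<Rightarrow> 'a set" where
  "slice X h \<alpha> = {y \<in> unit_ball X. h y > (SUP z\<in>unit_ball X. h z) - \<alpha>}"

definition supporting_functionals :: "'a::real_normed_vector set \<Rightarrow> 'a \<Rightarrow> ('a \<Rightarrow> real) set" where
  "supporting_functionals X x = {h \<in> dual X. dual_norm X h = 1 \<and> h x = 1}"

text \<open>
  For \<open>x\<close> in the unit sphere the supremum below is over a set that contains \<open>x\<close> and lies in the
  unit ball, so it is a genuine real supremum.
\<close>

definition frakD_point :: "'a::real_normed_vector set \<Rightarrow> 'a \<Rightarrow> bool" where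
  "frakD_point X x \<longleftrightarrow>
     x \<in> unit_sphere X \<and>
     (\<forall>h\<in>supporting_functionals X x. \<forall>\<alpha>>0. (SUP y\<in>slice X h \<alpha>. norm (x - y)) = 2)"

end

theory Submission
  imports Defs
begin

text \<open>
  The functional \<open>s\<close> that integrates against \<open>sgn f\<close> supports \<open>f\<close>, and so does the midpoint
  \<open>(h + s) / 2\<close>. A $\mathfrak{D}$-point \<open>f\<close> therefore admits \<open>g\<close> in the unit ball at distance almost
  \<open>2\<close> from \<open>f\<close> at which the midpoint is almost \<open>1\<close>. As \<open>h\<close> and \<open>s\<close> are at most \<open>1\<close> on the ball, both
  are then almost \<open>1\<close> at \<open>g\<close>. The value of \<open>s\<close> forces \<open>g\<close> to have nearly no mass where its sign
  disagrees with that of \<open>f\<close>, nor where \<open>f\<close> vanishes, while the distance forces \<open>f\<close> and \<open>g\<close> to have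
  nearly no common mass where the signs agree. So \<open>min \<bar>f\<bar> \<bar>g\<bar>\<close> has a small integral, and almost all
  of \<open>g\<close> lives where \<open>f\<close> is nonzero but smaller than \<open>g\<close>. This is, up to negligible mass, contained
  in a small set: \<open>0 < \<bar>f\<bar> < c\<close> has small measure for small \<open>c\<close>, and where \<open>\<bar>f\<bar> \<ge> c\<close> Markov's
  inequality bounds the measure (\<open>concentration_from_small_defect\<close>, \<open>frakD_point_concentration\<close>).

  For reflexive \<open>X\<close>, apply this with \<open>h = s\<close> to get \<open>g n\<close> in the ball with \<open>s (g n)\<close> tending to \<open>1\<close>
  that concentrate on sets \<open>D n\<close> of summable measure. By Tychonoff's theorem the evaluations at
  \<open>g n\<close> have a pointwise cluster point in the bidual, which reflexivity turns into a point \<open>x\<close> of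
  \<open>X\<close> (\<open>reflexive_ball_cluster_point\<close>). Off a tail union of the \<open>D n\<close> the mass of \<open>g n\<close> tends to \<open>0\<close>,
  so \<open>x\<close> vanishes there. By the Borel--Cantelli lemma the complements of the tail unions cover
  almost all of the interval, whence \<open>x = 0\<close> (\<open>vanishes_of_concentrating_weak_limit\<close>). But \<open>s x \<ge> 1\<close>,
  being a limit of the values \<open>s (g n)\<close>.
\<close>

section \<open>Slices determined by supporting functionals\<close>

lemma dualD:
  assumes "h \<in> dual X"
  shows "x \<notin> X \<Longrightarrow> h x = 0"
    and "x \<in> X \<Longrightarrow> y \<in> X \<Longrightarrow> h (x + y) = h x + h y"
    and "x \<in> X \<Longrightarrow> h (c *\<^sub>R x) = c * h x"
  using assms unfolding dual_def by blast+

lemma dual_bounded: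
  assumes "h \<in> dual X"
  shows "\<exists>K. \<forall>x\<in>X. \<bar>h x\<bar> \<le> K * norm x"
  using assms unfolding dual_def by blast

lemma dual_add:
  assumes h: "h \<in> dual X" and k: "k \<in> dual X"
  shows "(\<lambda>x. h x + k x) \<in> dual X"
proof -
  obtain K where K: "\<And>x. x \<in> X \<Longrightarrow> \<bar>h x\<bar> \<le> K * norm x" using dual_bounded[OF h] by blast
  obtain L where L: "\<And>x. x \<in> X \<Longrightarrow> \<bar>k x\<bar> \<le> L * norm x" using dual_bounded[OF k] by blast
  have "\<bar>h x + k x\<bar> \<le> (K + L) * norm x" if "x \<in> X" for x
    using K[OF that] L[OF that] abs_triangle_ineq[of "h x" "k x"] by (simp add: algebra_simps)
  then have "\<exists>K. \<forall>x\<in>X. \<bar>h x + k x\<bar> \<le> K * norm x" by blast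
  then show ?thesis
    unfolding dual_def using dualD[OF h] dualD[OF k] by (simp add: algebra_simps)
qed

lemma dual_scale:
  assumes h: "h \<in> dual X"
  shows "(\<lambda>x. c * h x) \<in> dual X"
proof -
  obtain K where K: "\<And>x. x \<in> X \<Longrightarrow> \<bar>h x\<bar> \<le> K * norm x" using dual_bounded[OF h] by blast
  have "\<bar>c * h x\<bar> \<le> (\<bar>c\<bar> * K) * norm x" if "x \<in> X" for x
    using mult_left_mono[OF K[OF that], of "\<bar>c\<bar>"] by (simp add: abs_mult mult.assoc)
  then have "\<exists>K. \<forall>x\<in>X. \<bar>c * h x\<bar> \<le> K * norm x" by blast
  then show ?thesis
    unfolding dual_def using dualD[OF h] by (simp add: algebra_simps)
qed

lemma abs_le_dual_norm:
  assumes "h \<in> dual X" "x \<in> unit_ball X"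
  shows "\<bar>h x\<bar> \<le> dual_norm X h"
proof -
  obtain K where K: "\<And>x. x \<in> X \<Longrightarrow> \<bar>h x\<bar> \<le> K * norm x"
    using dual_bounded[OF assms(1)] by blast
  have "\<bar>h y\<bar> \<le> \<bar>K\<bar>" if "y \<in> unit_ball X" for y
  proof -
    have y: "y \<in> X" "norm y \<le> 1" using that by (auto simp: unit_ball_def)
    have "\<bar>h y\<bar> \<le> K * norm y" by (rule K[OF y(1)])
    also have "\<dots> \<le> \<bar>K\<bar> * norm y" by (intro mult_right_mono) auto
    also have "\<dots> \<le> \<bar>K\<bar> * 1" by (intro mult_left_mono y(2)) auto
    finally show ?thesis by simp
  qed
  then have "bdd_above ((\<lambda>x. \<bar>h x\<bar>) ` unit_ball X)"
    by (rule bdd_aboveI2)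
  then show ?thesis
    unfolding dual_norm_def using assms(2) by (rule cSUP_upper2) simp
qed

lemma supporting_functionalsI:
  assumes "h \<in> dual X" "f \<in> unit_sphere X" "h f = 1"
    and bound: "\<And>x. x \<in> unit_ball X \<Longrightarrow> \<bar>h x\<bar> \<le> 1"
  shows "h \<in> supporting_functionals X f"
proof -
  have f: "f \<in> unit_ball X" using assms(2) by (auto simp: unit_ball_def unit_sphere_def)
  then have "dual_norm X h \<le> 1"
    unfolding dual_norm_def by (intro cSUP_least bound) auto
  moreover have "1 \<le> dual_norm X h"
    using abs_le_dual_norm[OF assms(1) f] assms(3) by simp
  ultimately show ?thesis
    using assms by (simp add: supporting_functionals_def)
qed

lemma supporting_functional_le_1:
  assumes "h \<in> supporting_functionals X f" "x \<in> unit_ball X"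
  shows "\<bar>h x\<bar> \<le> 1"
  using assms abs_le_dual_norm[of h X x] by (auto simp: supporting_functionals_def)

lemma supporting_slice_eq:
  assumes h: "h \<in> supporting_functionals X f" and f: "f \<in> unit_sphere X"
  shows "slice X h \<alpha> = {y \<in> unit_ball X. h y > 1 - \<alpha>}"
proof -
  have "(SUP z\<in>unit_ball X. h z) = 1"
  proof (rule cSup_eq_maximum)
    show "1 \<in> h ` unit_ball X"
      using h f by (force simp: supporting_functionals_def unit_ball_def unit_sphere_def)
    show "y \<le> 1" if "y \<in> h ` unit_ball X" for y
      using that supporting_functional_le_1[OF h] by force
  qed
  then show ?thesis by (simp add: slice_def)
qed

lemma supporting_functionals_midpoint:
  assumes h: "h \<in> supporting_functionals X f" and k: "k \<in> supporting_functionals X f"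
    and f: "f \<in> unit_sphere X"
  shows "(\<lambda>x. (h x + k x) / 2) \<in> supporting_functionals X f"
proof (rule supporting_functionalsI[OF _ f])
  have hk: "h \<in> dual X" "k \<in> dual X" "h f = 1" "k f = 1"
    using h k by (auto simp: supporting_functionals_def)
  show "(\<lambda>x. (h x + k x) / 2) \<in> dual X"
    using dual_scale[OF dual_add[OF hk(1,2)], of "1 / 2"] by simp
  show "(h f + k f) / 2 = 1" using hk by simp
  show "\<bar>(h x + k x) / 2\<bar> \<le> 1" if "x \<in> unit_ball X" for x
    using supporting_functional_le_1[OF h that] supporting_functional_le_1[OF k that] by simp
qed

lemma frakD_point_far_point:
  assumes D: "frakD_point X f" and h: "h \<in> supporting_functionals X f"
    and "\<alpha> > 0" "\<eta> > 0"
  obtains y where "y \<in> unit_ball X" "h y > 1 - \<alpha>" "norm (f - y) > 2 - \<eta>"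
proof -
  have f: "f \<in> unit_sphere X" using D by (simp add: frakD_point_def)
  have "f \<in> slice X h \<alpha>"
    using h f \<open>\<alpha> > 0\<close> unfolding supporting_slice_eq[OF h f]
    by (auto simp: supporting_functionals_def unit_ball_def unit_sphere_def)
  moreover have "(SUP y\<in>slice X h \<alpha>. norm (f - y)) = 2"
    using D h \<open>\<alpha> > 0\<close> by (simp add: frakD_point_def)
  ultimately have "\<exists>z\<in>(\<lambda>y. norm (f - y)) ` slice X h \<alpha>. 2 - \<eta> < z"
    using \<open>\<eta> > 0\<close> by (intro less_cSupD) auto
  then show thesis
    using that unfolding supporting_slice_eq[OF h f] by auto
qed

section \<open>Representatives and bounded weights\<close>

lemma norm_L1_rep: "norm x = (LINT t|lebesgue_on {0..1}. \<bar>rep_L1 x t\<bar>)"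
  by (simp add: norm_L1_def)

lemma rep_L1_add: "AE t in lebesgue_on {0..1}. rep_L1 (x + y) t = rep_L1 x t + rep_L1 y t"
proof -
  have "x + y = abs_L1 (\<lambda>t. rep_L1 x t + rep_L1 y t)"
    by (simp add: plus_L1_def)
  then show ?thesis
    using L1_rel_rep_abs[of "\<lambda>t. rep_L1 x t + rep_L1 y t"] integrable_rep_L1
    by (simp add: L1_rel_def)
qed

lemma rep_L1_diff: "AE t in lebesgue_on {0..1}. rep_L1 (x - y) t = rep_L1 x t - rep_L1 y t"
proof -
  have "x - y = abs_L1 (\<lambda>t. rep_L1 x t - rep_L1 y t)"
    by (simp add: minus_L1_def)
  then show ?thesis
    using L1_rel_rep_abs[of "\<lambda>t. rep_L1 x t - rep_L1 y t"] integrable_rep_L1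
    by (simp add: L1_rel_def)
qed

lemma rep_L1_scaleR: "AE t in lebesgue_on {0..1}. rep_L1 (c *\<^sub>R x) t = c * rep_L1 x t"
proof -
  have "c *\<^sub>R x = abs_L1 (\<lambda>t. c * rep_L1 x t)"
    by (simp add: scaleR_L1_def)
  then show ?thesis
    using L1_rel_rep_abs[of "\<lambda>t. c * rep_L1 x t"] integrable_rep_L1
    by (simp add: L1_rel_def)
qed

lemma measurable_rep_L1 [measurable]: "rep_L1 x \<in> borel_measurable (lebesgue_on {0..1})"
  using integrable_rep_L1 by (rule borel_measurable_integrable)

definition weighted_integral :: "L1 set \<Rightarrow> (real \<Rightarrow> real) \<Rightarrow> L1 \<Rightarrow> real" where
  "weighted_integral X \<phi> x =
     (if x \<in> X then LINT t|lebesgue_on {0..1}. \<phi> t * rep_L1 x t else 0)"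

context
  fixes \<phi> :: "real \<Rightarrow> real"
  assumes meas [measurable]: "\<phi> \<in> borel_measurable (lebesgue_on {0..1})"
    and bound: "\<And>t. \<bar>\<phi> t\<bar> \<le> 1"
begin

lemma integrable_weighted: "integrable (lebesgue_on {0..1}) (\<lambda>t. \<phi> t * rep_L1 x t)"
  using integrable_rep_L1[of x]
proof (rule Bochner_Integration.integrable_bound)
  show "AE t in lebesgue_on {0..1}. norm (\<phi> t * rep_L1 x t) \<le> norm (rep_L1 x t)"
    using mult_right_mono[OF bound] by (auto simp: abs_mult)
qed measurable

lemma weighted_integral_le: "\<bar>weighted_integral X \<phi> x\<bar> \<le> norm x"
proof -
  have "\<bar>LINT t|lebesgue_on {0..1}. \<phi> t * rep_L1 x t\<bar>
      \<le> (LINT t|lebesgue_on {0..1}. \<bar>\<phi> t * rep_L1 x t\<bar>)"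
    by (rule integral_abs_bound)
  also have "\<dots> \<le> norm x"
    unfolding norm_L1_rep using mult_right_mono[OF bound]
    by (intro integral_mono integrable_abs integrable_weighted integrable_rep_L1) (simp add: abs_mult)
  finally show ?thesis by (simp add: weighted_integral_def)
qed

lemma weighted_integral_in_dual:
  assumes "subspace X"
  shows "weighted_integral X \<phi> \<in> dual X"
proof -
  have add: "weighted_integral X \<phi> (x + y) = weighted_integral X \<phi> x + weighted_integral X \<phi> y"
    if "x \<in> X" "y \<in> X" for x y
  proof -
    have "(LINT t|lebesgue_on {0..1}. \<phi> t * rep_L1 (x + y) t)
        = (LINT t|lebesgue_on {0..1}. \<phi> t * rep_L1 x t + \<phi> t * rep_L1 y t)"
      using rep_L1_add[of x y] by (intro integral_cong_AE) (auto simp: algebra_simps)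
    also have "\<dots> = (LINT t|lebesgue_on {0..1}. \<phi> t * rep_L1 x t)
        + (LINT t|lebesgue_on {0..1}. \<phi> t * rep_L1 y t)"
      by (intro Bochner_Integration.integral_add integrable_weighted)
    finally show ?thesis
      using that subspace_add[OF assms] by (simp add: weighted_integral_def)
  qed
  have scale: "weighted_integral X \<phi> (c *\<^sub>R x) = c * weighted_integral X \<phi> x"
    if "x \<in> X" for c x
  proof -
    have "(LINT t|lebesgue_on {0..1}. \<phi> t * rep_L1 (c *\<^sub>R x) t)
        = (LINT t|lebesgue_on {0..1}. c * (\<phi> t * rep_L1 x t))"
      using rep_L1_scaleR[of c x] by (intro integral_cong_AE) auto
    also have "\<dots> = c * (LINT t|lebesgue_on {0..1}. \<phi> t * rep_L1 x t)"
      by (rule integral_mult_right_zero)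
    finally show ?thesis
      using that subspace_scale[OF assms] by (simp add: weighted_integral_def)
  qed
  have "\<exists>K. \<forall>x\<in>X. \<bar>weighted_integral X \<phi> x\<bar> \<le> K * norm x"
    using weighted_integral_le by (intro exI[of _ 1]) simp
  then show ?thesis
    using add scale by (simp add: dual_def weighted_integral_def)
qed

end

text \<open>
  Being almost normed by this functional means having almost no mass outside the part of the
  support of \<open>f\<close> on which the signs agree.
\<close>

lemma sgn_functional_supporting:
  assumes "subspace X" "f \<in> unit_sphere X"
  shows "weighted_integral X (\<lambda>t. sgn (rep_L1 f t)) \<in> supporting_functionals X f"
proof (rule supporting_functionalsI[OF _ assms(2)])
  have m: "(\<lambda>t. sgn (rep_L1 f t)) \<in> borel_measurable (lebesgue_on {0..1})" by measurable
  have b: "\<bar>sgn (rep_L1 f t)\<bar> \<le> 1" for t by (simp add: sgn_real_def)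
  show "weighted_integral X (\<lambda>t. sgn (rep_L1 f t)) \<in> dual X"
    by (rule weighted_integral_in_dual[OF m b assms(1)])
  show "weighted_integral X (\<lambda>t. sgn (rep_L1 f t)) f = 1"
    using assms(2) by (simp add: weighted_integral_def unit_sphere_def norm_L1_rep linordered_idom_class.abs_sgn mult.commute)
  show "\<bar>weighted_integral X (\<lambda>t. sgn (rep_L1 f t)) x\<bar> \<le> 1" if "x \<in> unit_ball X" for x
    using weighted_integral_le[OF m b, of X x] that by (simp add: unit_ball_def)
qed

section \<open>Concentration on small sets\<close>

text \<open>
  The sets where \<open>0 < \<bar>f\<bar> < c\<close> decrease to the empty set as \<open>c\<close> decreases to \<open>0\<close>. Excluding the
  zeros of \<open>f\<close> is essential, since they may form a set of large measure.
\<close>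

lemma measure_small_nonzero_values:
  fixes f :: "'a \<Rightarrow> real"
  assumes "finite_measure M" and [measurable]: "f \<in> borel_measurable M" and "\<delta> > 0"
  obtains c where "c > 0" "measure M {t \<in> space M. 0 < \<bar>f t\<bar> \<and> \<bar>f t\<bar> < c} < \<delta>"
proof -
  interpret finite_measure M by fact
  define A where "A n = {t \<in> space M. 0 < \<bar>f t\<bar> \<and> \<bar>f t\<bar> < inverse (real (Suc n))}" for n
  have "A n \<in> sets M" for n unfolding A_def by measurable
  moreover have "decseq A"
  proof (rule decseq_SucI)
    fix n
    have "inverse (real (Suc (Suc n))) \<le> inverse (real (Suc n))"
      by (intro le_imp_inverse_le) auto
    then show "A (Suc n) \<subseteq> A n" unfolding A_def by (auto intro: less_le_trans simp del: of_nat_Suc)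
  qed
  ultimately have "(\<lambda>n. measure M (A n)) \<longlonglongrightarrow> measure M (\<Inter>n. A n)"
    by (intro finite_Lim_measure_decseq) auto
  moreover have "(\<Inter>n. A n) = {}"
  proof (rule equals0I)
    fix t assume t: "t \<in> (\<Inter>n. A n)"
    then have "0 < \<bar>f t\<bar>" by (auto simp: A_def)
    then obtain n where "inverse (real (Suc n)) < \<bar>f t\<bar>" using reals_Archimedean by blast
    moreover have "t \<in> A n" using t by blast
    ultimately show False by (auto simp: A_def)
  qed
  ultimately have "(\<lambda>n. measure M (A n)) \<longlonglongrightarrow> 0" by simp
  then have "\<forall>\<^sub>F n in sequentially. measure M (A n) < \<delta>"
    using \<open>\<delta> > 0\<close> by (rule order_tendstoD)
  then obtain n where "measure M (A n) < \<delta>" by (auto simp: eventually_sequentially)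
  then show thesis by (intro that[of "inverse (real (Suc n))"]) (auto simp: A_def)
qed

text \<open>
  The first summand of \<open>w\<close> measures how far \<open>a\<close> and \<open>b\<close> are from \<open>\<bar>a - b\<bar> = \<bar>a\<bar> + \<bar>b\<bar>\<close>; it is
  \<open>2 * min \<bar>a\<bar> \<bar>b\<bar>\<close> if they have the same sign and \<open>0\<close> otherwise. The second is \<open>2 * \<bar>b\<bar>\<close> for
  opposite signs and \<open>\<bar>b\<bar>\<close> for \<open>a = 0\<close>. So \<open>w\<close> controls \<open>b\<close> unless \<open>a\<close> is nonzero, of the same sign
  as \<open>b\<close>, and small compared with \<open>b\<close>.
\<close>

lemma abs_le_of_small_defect:
  fixes a b :: real
  defines "w \<equiv> (\<bar>a\<bar> + \<bar>b\<bar> - \<bar>a - b\<bar>) + (\<bar>b\<bar> - sgn a * b)"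
  shows "0 \<le> w"
    and "a = 0 \<or> c \<le> \<bar>a\<bar> \<Longrightarrow> w < c \<Longrightarrow> \<bar>b\<bar> \<le> w"
  unfolding w_def by (auto simp: sgn_real_def abs_if split: if_splits)

text \<open>
  The set \<open>D\<close> joins the two places where the pointwise estimate gives nothing: where \<open>f\<close> is nonzero
  but below \<open>c\<close>, and where \<open>w \<ge> c\<close>, which Markov's inequality makes small. Everywhere else
  \<open>\<bar>g\<bar> \<le> w\<close>, so restricting to \<open>D\<close> loses at most the integral of \<open>w\<close>.
\<close>

lemma concentration_from_small_defect:
  fixes f g :: "'a \<Rightarrow> real"
  defines "w \<equiv> \<lambda>t. (\<bar>f t\<bar> + \<bar>g t\<bar> - \<bar>f t - g t\<bar>) + (\<bar>g t\<bar> - sgn (f t) * g t)"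
  assumes "finite_measure M" "integrable M f" "integrable M g" "c > 0"
  shows "\<exists>D\<in>sets M.
     measure M D \<le> measure M {t \<in> space M. 0 < \<bar>f t\<bar> \<and> \<bar>f t\<bar> < c} + (LINT t|M. w t) / c \<and>
     (LINT t:D|M. \<bar>g t\<bar>) \<ge> (LINT t|M. \<bar>g t\<bar>) - (LINT t|M. w t)"
proof -
  interpret finite_measure M by fact
  note [measurable] = borel_measurable_integrable[OF assms(3)] borel_measurable_integrable[OF assms(4)]
  define A where "A = {t \<in> space M. 0 < \<bar>f t\<bar> \<and> \<bar>f t\<bar> < c}"
  define B where "B = {t \<in> space M. c \<le> w t}"
  have "integrable M (\<lambda>t. sgn (f t) * g t)"
    using assms(4) by (rule Bochner_Integration.integrable_bound) (auto simp: sgn_real_def)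
  then have w: "integrable M w"
    unfolding w_def using assms(3,4) by (intro Bochner_Integration.integrable_add
      Bochner_Integration.integrable_diff integrable_abs) auto
  note [measurable] = borel_measurable_integrable[OF w]
  have AB [measurable]: "A \<in> sets M" "B \<in> sets M" unfolding A_def B_def by measurable
  have w0: "0 \<le> w t" for t unfolding w_def by (rule abs_le_of_small_defect)
  have "measure M (A \<union> B) \<le> measure M A + measure M B"
    using AB by (rule measure_Un_le)
  moreover have "measure M B \<le> (LINT t|M. w t) / c"
    unfolding B_def using w0 \<open>c > 0\<close> by (intro integral_Markov_inequality_measure[OF w]) auto
  moreover have "(LINT t|M. \<bar>g t\<bar>) - (LINT t|M. w t) \<le> (LINT t:A \<union> B|M. \<bar>g t\<bar>)"
  proof -
    have "(LINT t|M. \<bar>g t\<bar>) \<le> (LINT t|M. indicator (A \<union> B) t *\<^sub>R \<bar>g t\<bar> + w t)"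
    proof (rule integral_mono)
      show "integrable M (\<lambda>t. indicator (A \<union> B) t *\<^sub>R \<bar>g t\<bar> + w t)"
        using w assms(4) by (intro Bochner_Integration.integrable_add integrable_mult_indicator) auto
      show "\<bar>g t\<bar> \<le> indicator (A \<union> B) t *\<^sub>R \<bar>g t\<bar> + w t" if "t \<in> space M" for t
      proof (cases "t \<in> A \<union> B")
        case True then show ?thesis using w0[of t] by simp
      next
        case False
        then have "f t = 0 \<or> c \<le> \<bar>f t\<bar>" "w t < c" using that by (auto simp: A_def B_def)
        then have "\<bar>g t\<bar> \<le> w t" unfolding w_def by (rule abs_le_of_small_defect)
        then show ?thesis using False by simp
      qed
    qed (use assms(4) in auto)
    also have "\<dots> = (LINT t:A \<union> B|M. \<bar>g t\<bar>) + (LINT t|M. w t)"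
      unfolding set_lebesgue_integral_def
      using w assms(4) by (intro Bochner_Integration.integral_add integrable_mult_indicator) auto
    finally show ?thesis by simp
  qed
  ultimately show ?thesis
    by (intro bexI[of _ "A \<union> B"]) (auto simp: A_def)
qed

lemma finite_measure_unit_interval: "finite_measure (lebesgue_on {0..1::real})"
  by (intro finite_measure_lebesgue_on) auto

text \<open>
  The slice of \<open>h\<close> alone would allow \<open>g\<close> to be far from \<open>f\<close> merely by having the opposite sign, with
  no concentration. Passing to the midpoint of \<open>h\<close> with the sign functional excludes this, at the
  price of doubling the width of the slice.
\<close>

lemma frakD_point_concentration:
  assumes X: "subspace X" and D: "frakD_point X f" and h: "h \<in> supporting_functionals X f"
    and pos: "\<epsilon> > 0" "\<delta> > 0" "\<gamma> > 0"
  shows "\<exists>D \<in> sets (lebesgue_on {0..1}). measure (lebesgue_on {0..1}) D < \<delta> \<and>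
           (\<exists>g \<in> slice X h \<gamma>. (LINT t:D|lebesgue_on {0..1}. \<bar>rep_L1 g t\<bar>) > 1 - \<epsilon>)"
proof -
  let ?M = "lebesgue_on {0..1::real}"
  have f: "f \<in> unit_sphere X" using D by (simp add: frakD_point_def)
  define s where "s = weighted_integral X (\<lambda>t. sgn (rep_L1 f t))"
  have s: "s \<in> supporting_functionals X f"
    unfolding s_def by (rule sgn_functional_supporting[OF X f])
  obtain c where c: "c > 0" "measure ?M {t \<in> space ?M. 0 < \<bar>rep_L1 f t\<bar> \<and> \<bar>rep_L1 f t\<bar> < c} < \<delta> / 2"
    by (rule measure_small_nonzero_values[OF finite_measure_unit_interval measurable_rep_L1, of "\<delta> / 2"])
       (use pos in auto)
  \<comment> \<open>The integral of the defect \<open>w\<close> will be below \<open>3 * \<alpha>\<close> and the norm of \<open>g\<close> above \<open>1 - 2 * \<alpha>\<close>, which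
      explains the factors: \<open>5\<close> for the mass in the small set, \<open>2\<close> for the slice of \<open>h\<close>, and \<open>6\<close> so
      that Markov's inequality uses up only half of \<open>\<delta>\<close>.\<close>
  define \<alpha> where "\<alpha> = min (\<epsilon> / 5) (min (\<gamma> / 2) (c * \<delta> / 6))"
  have \<alpha>: "\<alpha> > 0" "5 * \<alpha> \<le> \<epsilon>" "2 * \<alpha> \<le> \<gamma>" "3 * \<alpha> \<le> c * \<delta> / 2"
    using pos c(1) unfolding \<alpha>_def by auto
  obtain g where g: "g \<in> unit_ball X" "(h g + s g) / 2 > 1 - \<alpha>" "norm (f - g) > 2 - \<alpha>"
    using frakD_point_far_point[OF D supporting_functionals_midpoint[OF h s f] \<alpha>(1) \<alpha>(1)] .
  have "\<bar>h g\<bar> \<le> 1" "\<bar>s g\<bar> \<le> 1"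
    using supporting_functional_le_1 h s g(1) by blast+
  then have hs: "h g > 1 - 2 * \<alpha>" "s g > 1 - 2 * \<alpha>" using g(2) by auto
  have gX: "g \<in> X" "norm g \<le> 1" using g(1) by (auto simp: unit_ball_def)
  have sg: "s g = (LINT t|?M. sgn (rep_L1 f t) * rep_L1 g t)"
    using gX by (simp add: s_def weighted_integral_def)
  have sgn1: "\<bar>sgn (rep_L1 f t)\<bar> \<le> 1" for t by (simp add: sgn_real_def)
  have sgnm: "(\<lambda>t. sgn (rep_L1 f t)) \<in> borel_measurable ?M" by measurable
  have "norm g > 1 - 2 * \<alpha>"
    using hs(2) weighted_integral_le[OF sgnm sgn1, of X g] by (simp add: s_def)
  define w where "w = (\<lambda>t. (\<bar>rep_L1 f t\<bar> + \<bar>rep_L1 g t\<bar> - \<bar>rep_L1 f t - rep_L1 g t\<bar>)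
       + (\<bar>rep_L1 g t\<bar> - sgn (rep_L1 f t) * rep_L1 g t))"
  have nd: "norm (f - g) = (LINT t|?M. \<bar>rep_L1 f t - rep_L1 g t\<bar>)"
    unfolding norm_L1_rep using rep_L1_diff[of f g] by (intro integral_cong_AE) auto
  have "(LINT t|?M. w t) = (norm f + norm g - norm (f - g)) + (norm g - s g)"
    unfolding w_def nd sg norm_L1_rep[of f] norm_L1_rep[of g]
    using integrable_rep_L1[of f] integrable_rep_L1[of g] integrable_weighted[OF sgnm sgn1, of g]
    by simp
  also have "\<dots> < 3 * \<alpha>"
    using f gX(2) g(3) hs(2) by (simp add: unit_sphere_def)
  finally have w: "(LINT t|?M. w t) < 3 * \<alpha>" .
  then have "(LINT t|?M. w t) / c < \<delta> / 2"
    using c(1) \<alpha>(4) by (simp add: field_simps)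
  moreover obtain E where E: "E \<in> sets ?M"
      "measure ?M E \<le> measure ?M {t \<in> space ?M. 0 < \<bar>rep_L1 f t\<bar> \<and> \<bar>rep_L1 f t\<bar> < c} + (LINT t|?M. w t) / c"
      "(LINT t:E|?M. \<bar>rep_L1 g t\<bar>) \<ge> norm g - (LINT t|?M. w t)"
    using concentration_from_small_defect[OF finite_measure_unit_interval integrable_rep_L1[of f]
        integrable_rep_L1[of g] c(1)]
    unfolding w_def norm_L1_rep by blast
  ultimately have "measure ?M E < \<delta>" using c(2) by linarith
  moreover have "(LINT t:E|?M. \<bar>rep_L1 g t\<bar>) > 1 - \<epsilon>"
    using E(3) w \<open>norm g > 1 - 2 * \<alpha>\<close> \<alpha>(2) by linarith
  moreover have "g \<in> slice X h \<gamma>"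
    unfolding supporting_slice_eq[OF h f] using g(1) hs(1) \<alpha>(3) by simp
  ultimately show ?thesis using E(1) by blast
qed

section \<open>Weak cluster points in reflexive subspaces\<close>

text \<open>
  The evaluations at points of the ball lie in a product of compact intervals, so they have a
  pointwise cluster point there, and linearity and boundedness pass to it. The filter \<open>G\<close>, which
  refines \<open>sequentially\<close>, plays the part of a convergent subnet.
\<close>

lemma reflexive_ball_cluster_point:
  fixes g :: "nat \<Rightarrow> 'a::real_normed_vector"
  assumes X: "reflexive_space X" and g: "\<And>n. g n \<in> unit_ball X"
  obtains x G where "x \<in> X" "G \<noteq> bot" "G \<le> sequentially"
    "\<forall>h\<in>dual X. ((\<lambda>n. h (g n)) \<longlongrightarrow> h x) G"
proof -
  define \<Phi> where "\<Phi> n = canonical_embedding X (g n)" for n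
  have bound: "\<bar>h (g n)\<bar> \<le> dual_norm X h" if "h \<in> dual X" for h n
    using abs_le_dual_norm[OF that g] .
  define K where "K = PiE UNIV (\<lambda>h. if h \<in> dual X then cball (0::real) (dual_norm X h) else {0})"
  have "compactin (product_topology (\<lambda>_. euclidean) UNIV) K"
    unfolding K_def compactin_PiE by simp
  then have "compact K"
    by (simp add: euclidean_product_topology)
  moreover have "\<Phi> n \<in> K" for n
    using bound by (auto simp: \<Phi>_def K_def canonical_embedding_def)
  then have "eventually (\<lambda>y. y \<in> K) (filtermap \<Phi> sequentially)"
    by (simp add: eventually_filtermap)
  moreover have "filtermap \<Phi> sequentially \<noteq> bot"
    by (simp add: filtermap_bot_iff)
  ultimately obtain F where F: "F \<in> K" "inf (nhds F) (filtermap \<Phi> sequentially) \<noteq> bot"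
    unfolding compact_filter by blast
  \<comment> \<open>The cluster point as a limit along a filter on the indices: those \<open>n\<close> that are large and for
      which \<open>\<Phi> n\<close> is close to \<open>F\<close>.\<close>
  define G where "G = inf sequentially (filtercomap \<Phi> (nhds F))"
  have G: "G \<le> sequentially" "G \<noteq> bot"
  proof -
    show "G \<le> sequentially" by (simp add: G_def)
    show "G \<noteq> bot"
    proof
      assume "G = bot"
      then obtain P Q where PQ: "eventually P sequentially" "eventually Q (nhds F)"
          "\<And>n. P n \<Longrightarrow> \<not> Q (\<Phi> n)"
        unfolding G_def trivial_limit_def eventually_inf eventually_filtercomap by blast
      have "eventually (\<lambda>y. \<not> Q y) (filtermap \<Phi> sequentially)"
        unfolding eventually_filtermap using PQ(1) by (rule eventually_mono) (rule PQ(3))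
      with PQ(2) have "eventually (\<lambda>_. False) (inf (nhds F) (filtermap \<Phi> sequentially))"
        unfolding eventually_inf by blast
      then show False using F(2) by (simp add: trivial_limit_def)
    qed
  qed
  have "(\<Phi> \<longlongrightarrow> F) G"
    unfolding G_def filterlim_def by (metis filtermap_filtercomap filtermap_mono inf_le2 order_trans)
  then have lim: "((\<lambda>n. \<Phi> n h) \<longlongrightarrow> F h) G" for h
    by (rule continuous_on_tendsto_compose[OF continuous_on_product_coordinates _ UNIV_I]) simp
  then have lim': "((\<lambda>n. h (g n)) \<longlongrightarrow> F h) G" if "h \<in> dual X" for h
    using lim[of h] that by (simp add: \<Phi>_def canonical_embedding_def)
  have "F \<in> bidual X"
  proof -
    have "F (\<lambda>x. h x + k x) = F h + F k" if "h \<in> dual X" "k \<in> dual X" for h k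
      using G(2) lim'[OF dual_add[OF that]] tendsto_add[OF lim'[OF that(1)] lim'[OF that(2)]]
      by (rule tendsto_unique)
    moreover have "F (\<lambda>x. c * h x) = c * F h" if "h \<in> dual X" for h c
      using G(2) lim'[OF dual_scale[OF that]] tendsto_mult_left[OF lim'[OF that]]
      by (rule tendsto_unique)
    moreover have "F h = 0" if "h \<notin> dual X" for h
      using PiE_mem[OF F(1)[unfolded K_def], of h] that by simp
    moreover have "\<bar>F h\<bar> \<le> 1 * dual_norm X h" if "h \<in> dual X" for h
      using PiE_mem[OF F(1)[unfolded K_def], of h] that by simp
    ultimately show ?thesis unfolding bidual_def by blast
  qed
  then obtain x where x: "x \<in> X" "F = canonical_embedding X x"
    using X unfolding reflexive_space_def by blast
  show thesis
    using x lim' by (intro that[OF x(1) G(2,1)]) (simp add: canonical_embedding_def)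
qed

text \<open>
  Testing the weak limit \<open>x\<close> against the sign of \<open>x\<close> on the set \<open>B N\<close> that all \<open>D n\<close> with \<open>n \<ge> N\<close> avoid
  gives the mass of \<open>x\<close> on \<open>B N\<close>; for the \<open>g n\<close> it gives at most their mass off \<open>D n\<close>, which tends to
  \<open>0\<close>. Summability of the measures is what makes the \<open>B N\<close> cover almost every point.
\<close>

lemma vanishes_of_concentrating_weak_limit:
  assumes X: "subspace X" and g: "\<And>n. g n \<in> unit_ball X"
    and D: "\<And>n. D n \<in> sets (lebesgue_on {0..1})"
    and sum: "summable (\<lambda>n. measure (lebesgue_on {0..1}) (D n))"
    and conc: "\<And>n. (LINT t:D n|lebesgue_on {0..1}. \<bar>rep_L1 (g n) t\<bar>) > 1 - e n"
    and e: "e \<longlonglongrightarrow> 0"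
    and x: "x \<in> X" and G: "G \<noteq> bot" "G \<le> sequentially"
    and lim: "\<forall>h\<in>dual X. ((\<lambda>n. h (g n)) \<longlongrightarrow> h x) G"
  shows "x = 0"
proof -
  let ?M = "lebesgue_on {0..1::real}"
  interpret finite_measure ?M by (rule finite_measure_unit_interval)
  note [measurable] = D
  define B where "B N = {t \<in> space ?M. \<forall>n\<ge>N. t \<notin> D n}" for N
  have B [measurable]: "B N \<in> sets ?M" for N unfolding B_def by measurable
  have "AE t in ?M. t \<in> B N \<longrightarrow> rep_L1 x t = 0" for N
  proof -
    define \<phi> where "\<phi> t = indicator (B N) t * sgn (rep_L1 x t)" for t
    have m: "\<phi> \<in> borel_measurable ?M" unfolding \<phi>_def by measurable
    have b: "\<bar>\<phi> t\<bar> \<le> 1" for t by (simp add: \<phi>_def indicator_def sgn_real_def)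
    let ?k = "weighted_integral X \<phi>"
    have small: "\<bar>?k (g n)\<bar> \<le> e n" if "N \<le> n" for n
    proof -
      have gn: "g n \<in> X" "norm (g n) \<le> 1" using g[of n] by (auto simp: unit_ball_def)
      have int: "integrable ?M (\<lambda>t. indicator (D n) t *\<^sub>R \<bar>rep_L1 (g n) t\<bar>)"
        using integrable_rep_L1[of "g n"] D by (intro integrable_mult_indicator) auto
      have "\<bar>?k (g n)\<bar> \<le> (LINT t|?M. \<bar>\<phi> t * rep_L1 (g n) t\<bar>)"
        using gn integral_abs_bound by (auto simp: weighted_integral_def)
      also have "\<dots> \<le> (LINT t|?M. \<bar>rep_L1 (g n) t\<bar> - indicator (D n) t *\<^sub>R \<bar>rep_L1 (g n) t\<bar>)"
      proof (rule integral_mono)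
        show "\<bar>\<phi> t * rep_L1 (g n) t\<bar> \<le> \<bar>rep_L1 (g n) t\<bar> - indicator (D n) t *\<^sub>R \<bar>rep_L1 (g n) t\<bar>" for t
        proof (cases "t \<in> D n")
          case True
          then have "t \<notin> B N" using that by (auto simp: B_def)
          then show ?thesis using True by (simp add: \<phi>_def)
        next
          case False
          then show ?thesis
            using mult_right_mono[OF b, of "\<bar>rep_L1 (g n) t\<bar>" t] by (simp add: abs_mult)
        qed
      qed (use integrable_weighted[OF m b] integrable_rep_L1[of "g n"] int in auto)
      also have "\<dots> = norm (g n) - (LINT t:D n|?M. \<bar>rep_L1 (g n) t\<bar>)"
        unfolding norm_L1_rep set_lebesgue_integral_def
        using integrable_rep_L1[of "g n"] int by simp
      also have "\<dots> \<le> e n" using conc[of n] gn(2) by linarith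
      finally show ?thesis .
    qed
    have "(\<lambda>n. ?k (g n)) \<longlonglongrightarrow> 0"
      using e by (rule Lim_null_comparison[rotated])
        (use small in \<open>auto simp: eventually_sequentially\<close>)
    then have "((\<lambda>n. ?k (g n)) \<longlongrightarrow> 0) G"
      using G(2) by (rule tendsto_mono[rotated])
    then have "?k x = 0"
      using tendsto_unique[OF G(1) bspec[OF lim weighted_integral_in_dual[OF m b X]]] by simp
    then have "(LINT t|?M. \<phi> t * rep_L1 x t) = 0" using x by (simp add: weighted_integral_def)
    moreover have nn: "0 \<le> \<phi> t * rep_L1 x t" for t
      by (auto simp: \<phi>_def indicator_def sgn_real_def)
    ultimately have "AE t in ?M. \<phi> t * rep_L1 x t = 0"
      using integral_nonneg_eq_0_iff_AE[OF integrable_weighted[OF m b, of x]] by auto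
    then show ?thesis by (rule AE_mp) (auto simp: \<phi>_def sgn_real_def split: if_splits)
  qed
  then have "AE t in ?M. \<forall>N. t \<in> B N \<longrightarrow> rep_L1 x t = 0"
    unfolding AE_all_countable by blast
  moreover have "AE t in ?M. \<forall>\<^sub>F n in sequentially. t \<in> space ?M - D n"
    using D sum by (intro borel_cantelli_AE1) (auto simp: emeasure_eq_measure)
  ultimately have "AE t in ?M. rep_L1 x t = 0"
    by (auto simp: eventually_sequentially B_def elim!: AE_mp)
  then have "norm x = (LINT t|?M. 0)"
    unfolding norm_L1_rep by (intro integral_cong_AE) auto
  then show ?thesis by simp
qed

theorem proposition4p10:
  fixes X :: "L1 set"
  assumes "subspace X" and "closed X"
  shows "(\<forall>f \<in> unit_sphere X. \<forall>h \<in> supporting_functionals X f.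
            frakD_point X f \<longrightarrow>
            (\<forall>\<epsilon>>0. \<forall>\<delta>>0. \<forall>\<gamma>>0.
               \<exists>D \<in> sets (lebesgue_on {0..1}). measure (lebesgue_on {0..1}) D < \<delta> \<and>
                 (\<exists>g \<in> slice X h \<gamma>. (LINT t:D|lebesgue_on {0..1}. \<bar>rep_L1 g t\<bar>) > 1 - \<epsilon>)))
       \<and> (reflexive_space X \<longrightarrow> \<not> (\<exists>f \<in> X. frakD_point X f))"
proof (intro conjI impI ballI allI)
  show "\<exists>D \<in> sets (lebesgue_on {0..1}). measure (lebesgue_on {0..1}) D < \<delta> \<and>
      (\<exists>g \<in> slice X h \<gamma>. (LINT t:D|lebesgue_on {0..1}. \<bar>rep_L1 g t\<bar>) > 1 - \<epsilon>)"
    if "h \<in> supporting_functionals X f" "frakD_point X f" "\<epsilon> > 0" "\<delta> > 0" "\<gamma> > 0" for f h \<epsilon> \<delta> \<gamma>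
    using frakD_point_concentration[OF assms(1) that(2,1,3-5)] .
next
  assume R: "reflexive_space X"
  show "\<not> (\<exists>f \<in> X. frakD_point X f)"
  proof
    assume "\<exists>f \<in> X. frakD_point X f"
    then obtain f where Df: "frakD_point X f" by blast
    then have f: "f \<in> unit_sphere X" by (simp add: frakD_point_def)
    define h where "h = weighted_integral X (\<lambda>t. sgn (rep_L1 f t))"
    have h: "h \<in> supporting_functionals X f"
      unfolding h_def by (rule sgn_functional_supporting[OF assms(1) f])
    let ?e = "\<lambda>n. inverse (real (Suc n))"
    have "\<forall>n. \<exists>D g. D \<in> sets (lebesgue_on {0..1}) \<and> measure (lebesgue_on {0..1}) D < (1/2) ^ n \<and>
        g \<in> slice X h (?e n) \<and> (LINT t:D|lebesgue_on {0..1}. \<bar>rep_L1 g t\<bar>) > 1 - ?e n"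
    proof
      fix n
      have pos: "?e n > 0" "(1/2 :: real) ^ n > 0" by simp_all
      show "\<exists>D g. D \<in> sets (lebesgue_on {0..1}) \<and> measure (lebesgue_on {0..1}) D < (1/2) ^ n \<and>
        g \<in> slice X h (?e n) \<and> (LINT t:D|lebesgue_on {0..1}. \<bar>rep_L1 g t\<bar>) > 1 - ?e n"
        using frakD_point_concentration[OF assms(1) Df h pos(1) pos(2) pos(1)] by blast
    qed
    then obtain D g where Dg: "\<And>n. D n \<in> sets (lebesgue_on {0..1})"
        "\<And>n. measure (lebesgue_on {0..1}) (D n) < (1/2) ^ n"
        "\<And>n. g n \<in> slice X h (?e n)"
        "\<And>n. (LINT t:D n|lebesgue_on {0..1}. \<bar>rep_L1 (g n) t\<bar>) > 1 - ?e n"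
      by metis
    have g: "g n \<in> unit_ball X" "h (g n) > 1 - ?e n" for n
      using Dg(3)[of n] unfolding supporting_slice_eq[OF h f] by auto
    obtain x G where x: "x \<in> X" "G \<noteq> bot" "G \<le> sequentially"
        "\<forall>k\<in>dual X. ((\<lambda>n. k (g n)) \<longlongrightarrow> k x) G"
      using reflexive_ball_cluster_point[of X g, OF R g(1)] .
    have "summable (\<lambda>n. measure (lebesgue_on {0..1}) (D n))"
      by (rule summable_comparison_test'[of "\<lambda>n. (1/2 :: real) ^ n"])
         (use Dg(2) in \<open>auto intro: less_imp_le\<close>)
    then have "x = 0"
      using vanishes_of_concentrating_weak_limit[OF assms(1) g(1) Dg(1) _ Dg(4)
          LIMSEQ_inverse_real_of_nat x] by simp
    then have "h x = 0"
      using dualD(3)[of h X x 0] h x(1) by (simp add: supporting_functionals_def)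
    moreover have "1 \<le> h x"
    proof (rule tendsto_le[OF x(2)])
      show "((\<lambda>n. h (g n)) \<longlongrightarrow> h x) G"
        using h by (intro bspec[OF x(4)]) (simp add: supporting_functionals_def)
      have "(\<lambda>n. 1 - ?e n) \<longlonglongrightarrow> 1"
        using tendsto_diff[OF tendsto_const LIMSEQ_inverse_real_of_nat, of 1] by simp
      then show "((\<lambda>n. 1 - ?e n) \<longlongrightarrow> 1) G"
        by (rule tendsto_mono[OF x(3)])
      show "\<forall>\<^sub>F n in G. 1 - ?e n \<le> h (g n)"
        using g(2) by (auto intro!: always_eventually less_imp_le)
    qed
    ultimately show False by simp
  qed
qed

end
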